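(* Every chain in the poset $P=2^{<\omega}\mathbin{\dot\cup}[0,1]$ (with the binary-expansion order defined in the context) is order-isomorphic to a suborder of the ordinal $\omega+1$. In particular, every chain in $P$ is countable.
   Context: Let $T=2^{<\omega}$ be the set of finite binary words with the prefix order $\preccurlyeq$, and $X=2^\omega$ the set of infinite binary sequences. For $s\in T$, $[s]=\{\alpha\in X: s \text{ is a prefix of }\alpha\}$. Let $\pi:X\to[0,1]$, $\pi(\alpha)=\sum_{n=0}^\infty \alpha(n)/2^{n+1}$. The poset $P=T\mathbin{\dot\cup}[0,1]$ (disjoint union) is ordered by: for $s,t\in T$, $s\le t$ iff $s\preccurlyeq t$; for $s\in T$, $r\in[0,1]$, $s\le r$ iff $r\in\pi([s])$; for $r,q\in[0,1]$, $r\le q$ iff $r=q$; no other comparabilities. *)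

theory Defs
  imports Complex_Main "HOL-Library.Sublist" "HOL-Library.Countable_Set"
    "HOL-Library.Extended_Nat"
begin

text \<open>Binary digits are booleans, so finite binary words have type \<^typ>\<open>bool list\<close> and
  infinite binary sequences have type \<^typ>\<open>nat \<Rightarrow> bool\<close>.  The ordinal omega + 1 is represented
  by \<^typ>\<open>enat\<close> with its usual order: a copy of the natural numbers below a top element.\<close>

definition cylinder :: "bool list \<Rightarrow> (nat \<Rightarrow> bool) set" where
  "cylinder s = {\<alpha>. \<forall>i<length s. \<alpha> i = s ! i}"

definition bin_val :: "(nat \<Rightarrow> bool) \<Rightarrow> real" where
  "bin_val \<alpha> = (\<Sum>n. of_bool (\<alpha> n) / 2 ^ (n + 1))"

definition tree_interval :: "(bool list + real) set" where
  "tree_interval = UNIV <+> {0..1}"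

fun tree_interval_le :: "bool list + real \<Rightarrow> bool list + real \<Rightarrow> bool" where
  "tree_interval_le (Inl s) (Inl t) \<longleftrightarrow> prefix s t"
| "tree_interval_le (Inl s) (Inr r) \<longleftrightarrow> r \<in> bin_val ` cylinder s"
| "tree_interval_le (Inr r) (Inr q) \<longleftrightarrow> r = q"
| "tree_interval_le (Inr r) (Inl s) \<longleftrightarrow> False"

text \<open>The order is restricted to the carrier, so every member of \<^term>\<open>Chains tree_interval_rel\<close>
  is a subset of \<^const>\<open>tree_interval\<close>.\<close>

definition tree_interval_rel :: "(bool list + real) rel" where
  "tree_interval_rel =
     {(x, y). x \<in> tree_interval \<and> y \<in> tree_interval \<and> tree_interval_le x y}"

lemma cylinder_antimono: "prefix s t \<Longrightarrow> cylinder t \<subseteq> cylinder s"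
  by (auto simp: cylinder_def prefix_def nth_append)

lemma partial_order_tree_interval: "partial_order_on tree_interval tree_interval_rel"
proof -
  have "tree_interval_le x z" if "tree_interval_le x y" "tree_interval_le y z" for x y z
    using that by (cases x; cases y; cases z) (auto dest: cylinder_antimono)
  moreover have "x = y" if "tree_interval_le x y" "tree_interval_le y x" for x y
    using that by (cases x; cases y) auto
  moreover have "tree_interval_le x x" for x by (cases x) auto
  ultimately show ?thesis
    unfolding partial_order_on_def preorder_on_def refl_on_def trans_def antisym_def
      tree_interval_rel_def by blast
qed

lemma Chains_tree_interval_subset: "C \<in> Chains tree_interval_rel \<Longrightarrow> C \<subseteq> tree_interval"
  by (auto simp: Chains_def tree_interval_rel_def)

end

theory Submission imports Defs begin

text \<open>A node of the tree is sent to its length and a real number to the top element: two comparable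
  words are ordered by length, and a chain contains at most one real number, above all its words.\<close>

fun tree_interval_rank :: "bool list + real \<Rightarrow> enat" where
  "tree_interval_rank (Inl s) = enat (length s)"
| "tree_interval_rank (Inr r) = \<infinity>"

text \<open>Comparability is essential: distinct words of equal length, or distinct reals, share a
  rank. Comparable reals are equal, and no real lies below a word.\<close>

lemma tree_interval_le_iff_rank_le:
  assumes "tree_interval_le x y \<or> tree_interval_le y x"
  shows "tree_interval_le x y \<longleftrightarrow> tree_interval_rank x \<le> tree_interval_rank y"
proof (cases x; cases y)
  fix s t assume "x = Inl s" "y = Inl t"
  with assms show ?thesis
    \<comment> \<open>If \<open>t\<close> is a prefix of \<open>s\<close> but not longer-ranked
      \<open>s\<close>, both are prefixes of \<open>s\<close>, so
      \<open>length s \<le> length t\<close> makes \<open>s\<close> a prefix of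
      \<open>t\<close>.\<close>
    by (auto dest: prefix_length_le intro: prefix_length_prefix)
qed (use assms in auto)

theorem lemma3p16:
  fixes C :: "(bool list + real) set"
  assumes "C \<in> Chains tree_interval_rel"
  shows "(\<exists>(A :: enat set) f. bij_betw f C A \<and>
           (\<forall>x\<in>C. \<forall>y\<in>C. (x, y) \<in> tree_interval_rel \<longleftrightarrow> f x \<le> f y))
         \<and> countable C"
proof -
  have embed: "(x, y) \<in> tree_interval_rel \<longleftrightarrow> tree_interval_rank x \<le> tree_interval_rank y"
    if "x \<in> C" "y \<in> C" for x y
  proof -
    have "(x, y) \<in> tree_interval_rel \<or> (y, x) \<in> tree_interval_rel"
      using assms that by (auto simp: Chains_def)
    then show ?thesis
      using tree_interval_le_iff_rank_le[of x y] by (auto simp: tree_interval_rel_def)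
  qed
  have "antisym tree_interval_rel"
    using partial_order_tree_interval by (simp add: partial_order_on_def)
  \<comment> \<open>Equal ranks give the relation in both directions.\<close>
  then have inj: "inj_on tree_interval_rank C"
    by (intro inj_onI) (metis antisymD embed order_refl)
  then have "countable C"
    \<comment> \<open>The type \<open>enat\<close> is countable.\<close>
    by (rule countableI')
  moreover have "bij_betw tree_interval_rank C (tree_interval_rank ` C)"
    using inj by (rule inj_on_imp_bij_betw)
  ultimately show ?thesis
    using embed by blast
qed

end
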